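(* For integers $n,k>0$, $$(-1)^{k-1}\left(\sum_{j=0}^{2k-1}(-1)^{j(j+1)/2}\,\sigma\,\mathrm{mex}\big(n-j(j+1)/2\big)-D_2^*(n)\right)=\sum_{j=0}^{n}MP_k(j)\,D_2^*(n-j).$$
   Context: For a partition $\lambda$, $\mathrm{mex}(\lambda)$ is the smallest positive integer that is not a part of $\lambda$ (the empty partition has mex $1$). For an integer $m\geqslant 0$, $\sigma\,\mathrm{mex}(m)$ is the sum of $\mathrm{mex}(\lambda)$ over all partitions $\lambda$ of $m$; $\sigma\,\mathrm{mex}(m)=0$ for $m<0$. $D_2^*(m)$ is the number of partitions of $m$ into distinct parts using two colors $0$ and $1$ (no colored part repeated) such that the parts of color $0$ are exactly $1,2,\dots,j$ for some $j\geqslant 0$ and only even parts can have color $1$. $MP_k(m)$ is the number of partitions of $m$ in which the first (smallest) part larger than $2k-1$ (which must exist) is odd and appears exactly $k$ times, and all other odd parts appear at most once. *)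

theory Defs
  imports "HOL-Library.Multiset"
begin

definition partitions_of :: "nat \<Rightarrow> nat multiset set" where
  "partitions_of n = {p. 0 \<notin># p \<and> sum_mset p = n}"

definition mex :: "nat multiset \<Rightarrow> nat" where
  "mex p = (LEAST i. 0 < i \<and> i \<notin># p)"

definition sigma_mex :: "int \<Rightarrow> nat" where
  "sigma_mex m = (if m < 0 then 0 else (\<Sum>p\<in>partitions_of (nat m). mex p))"

text \<open>A coloured part is a pair (part, colour) with colour 0 or 1.\<close>

definition colored_partitions_of :: "nat \<Rightarrow> (nat \<times> nat) multiset set" where
  "colored_partitions_of n =
    {p. (\<forall>(i, c)\<in>#p. 0 < i \<and> c \<in> {0, 1}) \<and> (\<Sum>(i, c)\<in>#p. i) = n}"

definition D2_star_set :: "nat \<Rightarrow> (nat \<times> nat) multiset set" where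
  "D2_star_set n =
    {p \<in> colored_partitions_of n.
       (\<forall>x. count p x \<le> 1) \<and>
       (\<exists>j. {i. (i, 0) \<in># p} = {1..j}) \<and>
       (\<forall>i. (i, 1) \<in># p \<longrightarrow> even i)}"

definition D2_star :: "nat \<Rightarrow> nat" where
  "D2_star n = card (D2_star_set n)"

text \<open>
  In the following, \<open>a\<close> is the smallest part larger than \<open>2 * k - 1\<close>; the condition on the other
  odd parts also concerns those not exceeding \<open>2 * k - 1\<close>. The definition is meant for \<open>k > 0\<close>,
  where the truncated subtraction is harmless.
\<close>

definition MP_set :: "nat \<Rightarrow> nat \<Rightarrow> nat multiset set" where
  "MP_set k n =
    {p \<in> partitions_of n.
       \<exists>a. a \<in># p \<and> 2 * k - 1 < a \<and> (\<forall>b. b \<in># p \<and> 2 * k - 1 < b \<longrightarrow> a \<le> b) \<and>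
           odd a \<and> count p a = k \<and>
           (\<forall>b. odd b \<and> b \<noteq> a \<longrightarrow> count p b \<le> 1)}"

definition MP :: "nat \<Rightarrow> nat \<Rightarrow> nat" where
  "MP k n = card (MP_set k n)"

text \<open>All the sets counted above are finite, so the cardinalities and sums are the intended ones.\<close>

lemma size_le_sum_mset:
  fixes f :: "'a \<Rightarrow> nat"
  assumes "\<And>x. x \<in># p \<Longrightarrow> 0 < f x"
  shows "size p \<le> (\<Sum>x\<in>#p. f x)"
  using assms
proof (induction p)
  case empty
  then show ?case by simp
next
  case (add x p)
  have "size p \<le> (\<Sum>x\<in>#p. f x)" "0 < f x"
    using add by simp_all
  then show ?case by simp
qed

lemma finite_bounded_mset:
  assumes "finite A"
  shows "finite {p. set_mset p \<subseteq> A \<and> size p \<le> n}"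
proof (rule finite_subset)
  show "{p. set_mset p \<subseteq> A \<and> size p \<le> n}
      \<subseteq> mset ` {xs. set xs \<subseteq> A \<and> length xs \<le> n}"
  proof
    fix p assume "p \<in> {p. set_mset p \<subseteq> A \<and> size p \<le> n}"
    moreover obtain xs where "mset xs = p" using ex_mset by blast
    ultimately show "p \<in> mset ` {xs. set xs \<subseteq> A \<and> length xs \<le> n}"
      by auto
  qed
  show "finite (mset ` {xs. set xs \<subseteq> A \<and> length xs \<le> n})"
    using finite_lists_length_le[OF assms] by simp
qed

lemma finite_partitions_of: "finite (partitions_of n)"
proof (rule finite_subset)
  show "partitions_of n \<subseteq> {p. set_mset p \<subseteq> {..n} \<and> size p \<le> n}"
  proof
    fix p assume p: "p \<in> partitions_of n"
    then have "size p \<le> (\<Sum>x\<in>#p. x)"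
      by (intro size_le_sum_mset) (auto simp: partitions_of_def intro: Suc_leI gr0I)
    moreover have "x \<le> sum_mset p" if "x \<in># p" for x
      using that by (metis insert_DiffM sum_mset.add_mset le_add1)
    ultimately show "p \<in> {p. set_mset p \<subseteq> {..n} \<and> size p \<le> n}"
      using p by (auto simp: partitions_of_def)
  qed
qed (rule finite_bounded_mset, simp)

lemma finite_colored_partitions_of: "finite (colored_partitions_of n)"
proof (rule finite_subset)
  show "colored_partitions_of n \<subseteq> {p. set_mset p \<subseteq> {..n} \<times> {0, 1} \<and> size p \<le> n}"
  proof
    fix p assume p: "p \<in> colored_partitions_of n"
    have sum: "(\<Sum>x\<in>#p. fst x) = n"
      using p by (simp add: colored_partitions_of_def case_prod_unfold)
    have "size p \<le> (\<Sum>x\<in>#p. fst x)"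
      using p by (intro size_le_sum_mset) (auto simp: colored_partitions_of_def)
    moreover have "fst x \<le> (\<Sum>x\<in>#p. fst x)" if "x \<in># p" for x
      using that by (metis insert_DiffM image_mset_add_mset sum_mset.add_mset le_add1)
    ultimately show "p \<in> {p. set_mset p \<subseteq> {..n} \<times> {0, 1} \<and> size p \<le> n}"
      using p sum by (fastforce simp: colored_partitions_of_def)
  qed
qed (rule finite_bounded_mset, simp)

lemma finite_D2_star_set: "finite (D2_star_set n)"
  by (rule finite_subset[OF _ finite_colored_partitions_of[of n]]) (auto simp: D2_star_set_def)

lemma finite_MP_set: "finite (MP_set k n)"
  by (rule finite_subset[OF _ finite_partitions_of[of n]]) (auto simp: MP_set_def)

end

(* Every generating function is truncated to parts at most 2 L + 1, where L = n + k; this turns all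
   products into finite ones and leaves the coefficients up to n unchanged. Counting the j with
   {1..j} contained in a partition gives \<sigma>mex = \<psi> / (q;q) with \<psi> = \<Sum>j. q^(j(j+1)/2), and
   D_2^* = \<psi> (-q^2;q^2). With P = (-q;q^2) / (q^2;q^2) this says \<sigma>mex = P D_2^*, so the factor \<psi>
   is never evaluated and the claim reduces to the truncated theta identity
     P \<Sum>j<2k. (-q)^(j(j+1)/2) = 1 + (-1)^(k-1) \<Sum>n. MP_k(n) q^n.
   This is proved by induction on k: by classifying according to the smallest part 2m+1 above
   2k-1, the series for MP_k + MP_{k+1} is a sum over m that telescopes. *)

theory Submission
  imports Defs "HOL-Computational_Algebra.Formal_Power_Series"
begin

unbundle fps_syntax

section \<open>Generating functions of multisets with prescribed multiplicities\<close>

text \<open>For \<open>w > 0\<close> this is the sum of \<open>q^(c*w)\<close> over \<open>c\<close>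
  in \<open>K\<close>; the existential form covers infinite \<open>K\<close> without a convergence
  argument.\<close>

definition multiplicity_series :: "nat \<Rightarrow> nat set \<Rightarrow> int fps" where
  "multiplicity_series w K = Abs_fps (\<lambda>n. of_bool (\<exists>c\<in>K. n = c * w))"

text \<open>The weight function lets one count serve both plain parts and coloured parts, which are
  weighted by their first component.\<close>

definition restricted_multisets ::
    "('a \<Rightarrow> nat) \<Rightarrow> 'a set \<Rightarrow> ('a \<Rightarrow> nat set) \<Rightarrow> nat \<Rightarrow> 'a multiset set" where
  "restricted_multisets w B K n =
    {p. set_mset p \<subseteq> B \<and> (\<forall>b\<in>B. count p b \<in> K b) \<and> (\<Sum>x\<in>#p. w x) = n}"

lemma finite_restricted_multisets:
  assumes "finite B" "\<And>b. b \<in> B \<Longrightarrow> 0 < w b"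
  shows "finite (restricted_multisets w B K n)"
proof (rule finite_subset[OF _ finite_bounded_mset[OF assms(1), of n]])
  show "restricted_multisets w B K n \<subseteq> {p. set_mset p \<subseteq> B \<and> size p \<le> n}"
    using assms(2) by (auto simp: restricted_multisets_def subset_iff intro!: size_le_sum_mset)
qed

text \<open>Removing all copies of \<open>b\<close> leaves a multiset over \<open>B\<close>; this
  remainder and the multiplicity of \<open>b\<close> determine the original.\<close>

lemma card_restricted_multisets_insert:
  assumes B: "finite B" "b \<notin> B" and w: "\<And>x. x \<in> insert b B \<Longrightarrow> 0 < w x"
  shows "card (restricted_multisets w (insert b B) K n) =
    (\<Sum>c | c \<in> K b \<and> c * w b \<le> n. card (restricted_multisets w B K (n - c * w b)))"
proof -
  let ?I = "{c. c \<in> K b \<and> c * w b \<le> n}"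
  let ?T = "\<lambda>c. restricted_multisets w B K (n - c * w b)"
  let ?f = "\<lambda>(c, p). replicate_mset c b + p"
  let ?g = "\<lambda>p. (count p b, filter_mset (\<lambda>x. x \<noteq> b) p)"
  have wb: "0 < w b" using w by simp
  have "c \<le> n" if "c * w b \<le> n" for c
  proof -
    have "c * 1 \<le> c * w b" using wb by (intro mult_le_mono2) simp
    then show ?thesis using that by linarith
  qed
  then have "?I \<subseteq> {..n}" by auto
  then have fin: "finite ?I" by (rule finite_subset) simp
  have split: "replicate_mset (count p b) b + filter_mset (\<lambda>x. x \<noteq> b) p = p" for p
    by (rule multiset_eqI) auto
  have "bij_betw ?f (Sigma ?I ?T) (restricted_multisets w (insert b B) K n)"
  proof (rule bij_betw_byWitness[where f' = ?g])
    show "\<forall>a\<in>Sigma ?I ?T. ?g (?f a) = a"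
    proof safe
      fix c p assume p: "p \<in> ?T c"
      then have "b \<notin># p" using B by (auto simp: restricted_multisets_def)
      then show "count (replicate_mset c b + p) b = c"
        "filter_mset (\<lambda>x. x \<noteq> b) (replicate_mset c b + p) = p"
        by (auto simp: not_in_iff multiset_eq_iff)
    qed
    show "\<forall>a\<in>restricted_multisets w (insert b B) K n. ?f (?g a) = a"
      using split by simp
    show "?f ` Sigma ?I ?T \<subseteq> restricted_multisets w (insert b B) K n"
    proof safe
      fix c p assume c: "c \<in> K b" "c * w b \<le> n" and p: "p \<in> ?T c"
      then have "count p b = 0" using B by (auto simp: restricted_multisets_def not_in_iff)
      then show "replicate_mset c b + p \<in> restricted_multisets w (insert b B) K n"
        using c p B by (auto simp: restricted_multisets_def)
    qed
    show "?g ` restricted_multisets w (insert b B) K n \<subseteq> Sigma ?I ?T"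
    proof (rule image_subsetI)
      fix p assume p: "p \<in> restricted_multisets w (insert b B) K n"
      have "(\<Sum>x\<in>#p. w x) =
          (\<Sum>x\<in>#replicate_mset (count p b) b + filter_mset (\<lambda>x. x \<noteq> b) p. w x)"
        by (simp only: split)
      then have "(\<Sum>x\<in>#p. w x) =
          count p b * w b + (\<Sum>x\<in>#filter_mset (\<lambda>x. x \<noteq> b) p. w x)"
        by simp
      then show "?g p \<in> Sigma ?I ?T"
        using p B by (auto simp: restricted_multisets_def)
    qed
  qed
  then have "card (restricted_multisets w (insert b B) K n) = card (Sigma ?I ?T)"
    by (simp add: bij_betw_same_card)
  also have "\<dots> = (\<Sum>c\<in>?I. card (?T c))"
    using fin finite_restricted_multisets[of B w] B w by (intro card_SigmaI) auto
  finally show ?thesis .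
qed

text \<open>The insertion formula is a Cauchy product with the series of the new element, so
  induction on \<open>B\<close> applies.\<close>

lemma card_restricted_multisets:
  assumes "finite B" "\<And>b. b \<in> B \<Longrightarrow> 0 < w b"
  shows "int (card (restricted_multisets w B K n)) =
    (\<Prod>b\<in>B. multiplicity_series (w b) (K b)) $ n"
  using assms
proof (induction B arbitrary: n rule: finite_induct)
  case empty
  have "restricted_multisets w {} K n = (if n = 0 then {{#}} else {})"
    by (auto simp: restricted_multisets_def)
  then show ?case by simp
next
  case (insert b B)
  let ?I = "{c. c \<in> K b \<and> c * w b \<le> n}"
  let ?P = "\<Prod>x\<in>B. multiplicity_series (w x) (K x)"
  have wb: "0 < w b" using insert.prems by simp
  have "int (card (restricted_multisets w (insert b B) K n)) =
      (\<Sum>c\<in>?I. int (card (restricted_multisets w B K (n - c * w b))))"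
    using insert by (subst card_restricted_multisets_insert) auto
  also have "\<dots> = (\<Sum>c\<in>?I. ?P $ (n - c * w b))"
    using insert by simp
  \<comment> \<open>Since \<open>w b\<close> is positive, different multiplicities give different
    exponents; exponents outside the image have coefficient 0 in the new factor.\<close>
  also have "\<dots> = (\<Sum>i\<in>(\<lambda>c. c * w b) ` ?I. ?P $ (n - i))"
    using wb by (subst sum.reindex) (auto simp: inj_on_def)
  also have "\<dots> = (\<Sum>i=0..n. multiplicity_series (w b) (K b) $ i * ?P $ (n - i))"
    by (intro sum.mono_neutral_cong_left) (auto simp: multiplicity_series_def)
  also have "\<dots> = (\<Prod>x\<in>insert b B. multiplicity_series (w x) (K x)) $ n"
    using insert by (simp add: fps_mult_nth)
  finally show ?case .
qed

abbreviation geometric :: "nat \<Rightarrow> int fps" where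
  "geometric w \<equiv> multiplicity_series w UNIV"

lemma multiplicity_series_singleton: "multiplicity_series w {c} = fps_X ^ (c * w)"
  by (rule fps_ext) (simp add: multiplicity_series_def)

lemma multiplicity_series_at_most_once:
  "0 < w \<Longrightarrow> multiplicity_series w {0, 1} = 1 + fps_X ^ w"
  by (rule fps_ext) (auto simp: multiplicity_series_def)

lemma positive_multiple_iff:
  "(\<exists>c>0. n = c * w) \<longleftrightarrow> w \<le> n \<and> (\<exists>c. n - w = c * w)" for n w :: nat
proof safe
  fix c :: nat assume c: "0 < c"
  then obtain d where "c = Suc d" by (cases c) auto
  then show "w \<le> c * w" "\<exists>d. c * w - w = d * w" by auto
next
  fix c assume "w \<le> n" "n - w = c * w"
  then have "n = Suc c * w" by simp
  then show "\<exists>c>0. n = c * w" by blast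
qed

text \<open>For \<open>n \<ge> w\<close>, either both or none of \<open>n\<close> and
  \<open>n - w\<close> are multiples of \<open>w\<close>, so the coefficients cancel. The product
  form avoids division.\<close>

lemma geometric_times:
  assumes "0 < w"
  shows "geometric w * (1 - fps_X ^ w) = 1"
proof (rule fps_ext)
  fix n
  have "(\<exists>c. n = c * w) \<longleftrightarrow> (\<exists>c. n - w = c * w)" if "w \<le> n"
    using that assms positive_multiple_iff[of n w] by (metis gr0I le_zero_eq mult_0 not_gr_zero)
  moreover have "(\<exists>c. n = c * w) \<longleftrightarrow> n = 0" if "n < w"
    using that by auto
  ultimately show "(geometric w * (1 - fps_X ^ w)) $ n = 1 $ n"
    using assms
    by (auto simp: multiplicity_series_def right_diff_distrib fps_X_power_mult_right_nth not_less)
qed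

lemma multiplicity_series_positive:
  assumes "0 < w"
  shows "multiplicity_series w {0<..} = fps_X ^ w * geometric w"
proof (rule fps_ext)
  fix n
  show "multiplicity_series w {0<..} $ n = (fps_X ^ w * geometric w) $ n"
    using positive_multiple_iff[of n w]
    by (auto simp: multiplicity_series_def fps_X_power_mult_nth not_less Bex_def)
qed

section \<open>Generating function of the mex sum\<close>

lemma mem_le_sum_mset: "x \<in># p \<Longrightarrow> x \<le> sum_mset p" for x :: nat
  by (metis insert_DiffM sum_mset.add_mset le_add1)

text \<open>No part of a partition of \<open>m\<close> exceeds \<open>m\<close>, so bounding the
  parts by \<open>N\<close> loses nothing.\<close>

lemma restricted_partitions:
  assumes "m \<le> N"
  shows "restricted_multisets (\<lambda>x. x) {1..N} K m =
    {p \<in> partitions_of m. \<forall>b\<in>{1..N}. count p b \<in> K b}"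
  using assms mem_le_sum_mset
  by (fastforce simp: restricted_multisets_def partitions_of_def Suc_le_eq intro!: gr0I)

text \<open>The indices counted are exactly 0, ..., \<open>mex p - 1\<close>: \<open>j = 0\<close>
  qualifies vacuously, and a positive \<open>j\<close> is itself a part, hence at most
  \<open>N\<close>.\<close>

lemma mex_eq_sum:
  assumes p: "p \<in> partitions_of m" and m: "m \<le> N"
  shows "mex p = (\<Sum>j\<le>N. of_bool ({1..j} \<subseteq> set_mset p))"
proof -
  have le: "x \<le> N" if "x \<in># p" for x
    using mem_le_sum_mset[OF that] p m by (simp add: partitions_of_def)
  have ex: "\<exists>i. 0 < i \<and> i \<notin># p"
    using le by (intro exI[of _ "Suc N"]) force
  have mex: "0 < mex p" "mex p \<notin># p"
    using LeastI_ex[OF ex] by (simp_all add: mex_def)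
  have below: "i \<in># p" if "0 < i" "i < mex p" for i
    using that not_less_Least[of i "\<lambda>i. 0 < i \<and> i \<notin># p"] by (auto simp: mex_def)
  have "{j \<in> {..N}. {1..j} \<subseteq> set_mset p} = {..<mex p}"
  proof (intro equalityI subsetI)
    fix j assume "j \<in> {j \<in> {..N}. {1..j} \<subseteq> set_mset p}"
    then have "\<not> mex p \<le> j" using mex by (auto simp: subset_iff Suc_le_eq)
    then show "j \<in> {..<mex p}" by simp
  next
    fix j assume j: "j \<in> {..<mex p}"
    then have "{1..j} \<subseteq> set_mset p" using below by auto
    moreover have "j \<le> N" using below[of j] le[of j] j by (cases "j = 0") auto
    ultimately show "j \<in> {j \<in> {..N}. {1..j} \<subseteq> set_mset p}" by simp
  qed
  then have "mex p = card {j \<in> {..N}. {1..j} \<subseteq> set_mset p}" by simp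
  also have "\<dots> = (\<Sum>j\<le>N. of_bool ({1..j} \<subseteq> set_mset p))"
    by (simp add: Int_def sum.If_cases of_bool_def)
  finally show ?thesis .
qed

text \<open>Truncation of Ramanujan's psi(q), the sum of \<open>q^(j*(j+1)/2)\<close>; the powers
  stay products because counting part by part delivers them so.\<close>

definition triangular_series :: "nat \<Rightarrow> int fps" where
  "triangular_series N = (\<Sum>j\<le>N. \<Prod>b=1..j. fps_X ^ b)"

lemma prod_staircase:
  assumes "j \<le> (N::nat)"
  shows "(\<Prod>b=1..N. if b \<le> j then f b else 1) = (\<Prod>b=1..j. f b :: 'a :: comm_monoid_mult)"
  using assms by (intro prod.mono_neutral_cong_right) auto

text \<open>For fixed \<open>j\<close> the parts 1, ..., \<open>j\<close> must occur, and requiring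
  a part \<open>b\<close> multiplies its unrestricted series by \<open>q^b\<close>. Summing over
  \<open>j\<close> then uses \<open>mex_eq_sum\<close>.\<close>

lemma sigma_mex_nth:
  assumes m: "m \<le> N"
  shows "int (sigma_mex (int m)) = (triangular_series N * (\<Prod>b=1..N. geometric b)) $ m"
proof -
  have count: "int (card {p \<in> partitions_of m. {1..j} \<subseteq> set_mset p}) =
      ((\<Prod>b=1..j. fps_X ^ b) * (\<Prod>b=1..N. geometric b)) $ m" if j: "j \<le> N" for j
  proof -
    let ?K = "\<lambda>b. if b \<le> j then {0<..} else UNIV"
    have "{p \<in> partitions_of m. {1..j} \<subseteq> set_mset p} =
        {p \<in> partitions_of m. \<forall>b\<in>{1..N}. count p b \<in> ?K b}"
      using j by (auto simp: subset_iff Suc_le_eq)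
    then have "int (card {p \<in> partitions_of m. {1..j} \<subseteq> set_mset p}) =
        (\<Prod>b=1..N. multiplicity_series b (?K b)) $ m"
      using card_restricted_multisets[of "{1..N}" "\<lambda>x. x" ?K m] restricted_partitions[OF m, of ?K]
      by simp
    also have "(\<Prod>b=1..N. multiplicity_series b (?K b)) =
        (\<Prod>b=1..N. (if b \<le> j then fps_X ^ b else 1) * geometric b)"
      by (intro prod.cong refl) (auto simp: multiplicity_series_positive)
    also have "\<dots> = (\<Prod>b=1..j. fps_X ^ b) * (\<Prod>b=1..N. geometric b)"
      by (simp only: prod.distrib prod_staircase[OF j])
    finally show ?thesis .
  qed
  have "sigma_mex (int m) = (\<Sum>p\<in>partitions_of m. \<Sum>j\<le>N. of_bool ({1..j} \<subseteq> set_mset p))"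
    unfolding sigma_mex_def using mex_eq_sum[OF _ m] by simp
  also have "\<dots> = (\<Sum>j\<le>N. card {p \<in> partitions_of m. {1..j} \<subseteq> set_mset p})"
    by (subst sum.swap) (simp add: finite_partitions_of Int_def of_bool_def sum.If_cases)
  finally show ?thesis
    using count by (simp add: triangular_series_def sum_distrib_right fps_sum_nth)
qed

section \<open>Generating function of the two-coloured partitions\<close>

text \<open>The odd truncation bound lets all factors except that of 1 pair up as an even number and
  its successor.\<close>

lemma prod_pairs:
  fixes f :: "nat \<Rightarrow> 'a :: comm_monoid_mult"
  shows "(\<Prod>b=1..2 * L + 1. f b) = f 1 * (\<Prod>i=1..L. f (2 * i) * f (2 * i + 1))"
  by (induction L) (simp_all add: mult_ac)

text \<open>Each \<open>j\<close> forces colour 0 to contribute \<open>q^(1+...+j)\<close>, while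
  colour 1 independently contributes \<open>1 + q^(2*i)\<close> for every even part.\<close>

lemma D2_star_nth:
  assumes m: "m \<le> 2 * L + 1"
  shows "int (D2_star m) =
    (triangular_series (2 * L + 1) * (\<Prod>i=1..L. 1 + fps_X ^ (2 * i))) $ m"
proof -
  let ?N = "2 * L + 1"
  define K :: "nat \<Rightarrow> nat \<times> nat \<Rightarrow> nat set" where
    "K j x = (if snd x = 0 then if fst x \<le> j then {1} else {0}
      else if even (fst x) then {0, 1} else {0})" for j x
  let ?B = "{1..?N} \<times> {0, 1::nat}"
  have le: "fst x \<le> m" if "p \<in> colored_partitions_of m" "x \<in># p" for p x
  proof -
    have "(\<Sum>x\<in>#p. fst x) = m"
      using that by (simp add: colored_partitions_of_def case_prod_unfold)
    then show ?thesis
      using that(2) by (metis insert_DiffM image_mset_add_mset sum_mset.add_mset le_add1)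
  qed
  have D: "D2_star_set m = (\<Union>j\<le>?N. restricted_multisets fst ?B (K j) m)"
  proof (intro equalityI subsetI)
    fix p assume p: "p \<in> D2_star_set m"
    then obtain j where j: "{i. (i, 0) \<in># p} = {1..j}"
      and cp: "p \<in> colored_partitions_of m" and once: "\<And>x. count p x \<le> 1"
      and ev: "\<And>i. (i, 1) \<in># p \<Longrightarrow> even i"
      by (auto simp: D2_star_set_def)
    have "j \<le> ?N"
    proof (cases "j = 0")
      case False
      then have "j \<in> {i. (i, 0) \<in># p}" using j by simp
      then show ?thesis using le[OF cp, of "(j, 0)"] m by simp
    qed simp
    moreover have "set_mset p \<subseteq> ?B"
    proof
      fix x assume x: "x \<in># p"
      then have "0 < fst x \<and> snd x \<in> {0, 1}"
        using cp by (auto simp: colored_partitions_of_def)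
      then show "x \<in> ?B" using le[OF cp x] m by (cases x) auto
    qed
    moreover have "count p x \<in> K j x" if "x \<in> ?B" for x
    proof -
      obtain i c where ic: "x = (i, c)" by (cases x)
      then have x: "x = (i, c)" "1 \<le> i" "c = 0 \<or> c = 1" using that by auto
      have c01: "count p x = 0 \<or> count p x = 1" using once[of x] by linarith
      have "(i, 0) \<in># p \<longleftrightarrow> i \<le> j" using j x(2) by auto
      then show ?thesis using x c01 ev[of i]
        by (auto simp: K_def count_greater_zero_iff[symmetric] simp del: count_greater_zero_iff)
    qed
    ultimately show "p \<in> (\<Union>j\<le>?N. restricted_multisets fst ?B (K j) m)"
      using cp by (auto simp: restricted_multisets_def colored_partitions_of_def case_prod_unfold)
  next
    fix p assume "p \<in> (\<Union>j\<le>?N. restricted_multisets fst ?B (K j) m)"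
    then obtain j where j: "j \<le> ?N" and sub: "set_mset p \<subseteq> ?B"
      and K: "\<And>x. x \<in> ?B \<Longrightarrow> count p x \<in> K j x" and sum: "(\<Sum>x\<in>#p. fst x) = m"
      by (auto simp: restricted_multisets_def)
    have "count p x \<le> 1" for x
    proof (cases "x \<in># p")
      case True
      then have "x \<in> ?B" using sub by blast
      then show ?thesis using K[of x] by (auto simp: K_def split: if_splits)
    qed (simp add: not_in_iff)
    moreover have "(i, 0) \<in># p \<longleftrightarrow> i \<in> {1..j}" for i
    proof
      assume i: "(i, 0) \<in># p"
      then have "(i, 0) \<in> ?B" using sub by blast
      then show "i \<in> {1..j}" using K[of "(i, 0)"] i by (auto simp: K_def count_eq_zero_iff split: if_splits)
    next
      assume "i \<in> {1..j}"
      then show "(i, 0) \<in># p"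
        using K[of "(i, 0)"] j by (auto simp: K_def intro!: count_inI)
    qed
    moreover have "even i" if "(i, 1) \<in># p" for i
    proof -
      have "(i, 1) \<in> ?B" using sub that by blast
      then show ?thesis using K[of "(i, 1)"] that
        by (auto simp: K_def count_eq_zero_iff split: if_splits)
    qed
    moreover have "p \<in> colored_partitions_of m"
      using sub sum by (fastforce simp: colored_partitions_of_def case_prod_unfold)
    ultimately show "p \<in> D2_star_set m"
      by (auto simp: D2_star_set_def)
  qed
  \<comment> \<open>The part \<open>j\<close> of colour 0 separates the sets: its multiplicity is 0
    for the smaller index and 1 for the larger.\<close>
  have disj: "restricted_multisets fst ?B (K i) m \<inter> restricted_multisets fst ?B (K j) m = {}"
    if "i < j" "j \<le> ?N" for i j
  proof -
    have "K i (j, 0) \<inter> K j (j, 0) = {}" "(j, 0) \<in> ?B" using that by (auto simp: K_def)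
    then show ?thesis unfolding restricted_multisets_def by blast
  qed
  have "card (D2_star_set m) = (\<Sum>j\<le>?N. card (restricted_multisets fst ?B (K j) m))"
    unfolding D
  proof (intro card_UN_disjoint ballI impI)
    fix i j assume "i \<in> {..?N}" "j \<in> {..?N}" "i \<noteq> j"
    then show "restricted_multisets fst ?B (K i) m \<inter> restricted_multisets fst ?B (K j) m = {}"
      using disj[of i j] disj[of j i] by (cases "i < j") (auto simp: Int_commute)
  qed (auto intro!: finite_restricted_multisets)
  moreover have "int (card (restricted_multisets fst ?B (K j) m)) =
      ((\<Prod>b=1..j. fps_X ^ b) * (\<Prod>i=1..L. 1 + fps_X ^ (2 * i))) $ m" if j: "j \<le> ?N" for j
  proof -
    have "int (card (restricted_multisets fst ?B (K j) m)) =
        (\<Prod>x\<in>?B. multiplicity_series (fst x) (K j x)) $ m"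
      by (rule card_restricted_multisets) auto
    also have "(\<Prod>x\<in>?B. multiplicity_series (fst x) (K j x)) =
        (\<Prod>b=1..?N. \<Prod>c\<in>{0, 1}. multiplicity_series b (K j (b, c)))"
      by (subst prod.cartesian_product) (simp add: case_prod_unfold)
    also have "\<dots> = (\<Prod>b=1..?N. (if b \<le> j then fps_X ^ b else 1) *
        (if even b then 1 + fps_X ^ b else 1))"
      by (intro prod.cong refl)
         (auto simp: K_def multiplicity_series_singleton multiplicity_series_at_most_once[simplified])
    also have "\<dots> = (\<Prod>b=1..j. fps_X ^ b) * (\<Prod>b=1..?N. if even b then 1 + fps_X ^ b else 1)"
      by (simp only: prod.distrib prod_staircase[OF j])
    also have "(\<Prod>b=1..?N. if even b then 1 + fps_X ^ b else (1 :: int fps)) =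
        (\<Prod>i=1..L. 1 + fps_X ^ (2 * i))"
      by (subst prod_pairs) simp
    finally show ?thesis .
  qed
  ultimately show ?thesis
    by (simp add: D2_star_def triangular_series_def sum_distrib_right fps_sum_nth
        del: sum.atMost_Suc)
qed

section \<open>Generating function of \<open>MP\<close>\<close>

text \<open>Pairing the even part \<open>2 * i\<close> with the odd part \<open>2 * i + 1\<close> leaves the part 1 alone, hence the
  extra factor in \<open>head\<close>; \<open>head (Suc L)\<close> is the full product \<open>P\<close>.\<close>

definition pair_factor :: "nat \<Rightarrow> int fps" where
  "pair_factor i = geometric (2 * i) * (1 + fps_X ^ (2 * i + 1))"

definition head :: "nat \<Rightarrow> int fps" where
  "head k = (1 + fps_X) * (\<Prod>i=1..<k. pair_factor i)"

definition tail :: "nat \<Rightarrow> nat \<Rightarrow> int fps" where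
  "tail L m = (\<Prod>i=m + 1..L. pair_factor i)"

text \<open>The summation variable is the index \<open>m\<close> of the smallest part \<open>2 * m + 1\<close> above \<open>2 * k - 1\<close>.\<close>

definition MP_series :: "nat \<Rightarrow> nat \<Rightarrow> int fps" where
  "MP_series L k = head k * (\<Sum>m=k..L. fps_X ^ (k * (2 * m + 1)) * tail L m)"

text \<open>Let \<open>2*i + 1\<close> be the smallest part above \<open>2*k - 1\<close>. The parts
  up to \<open>2*k - 1\<close> give \<open>head k\<close>, the chosen part gives
  \<open>q^(k*(2*i+1))\<close>, and the larger parts give \<open>tail L i\<close>.\<close>

lemma MP_nth:
  assumes m: "m \<le> 2 * L + 1" and k: "0 < k"
  shows "int (MP k m) = MP_series L k $ m"
proof -
  let ?N = "2 * L + 1"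
  define K :: "nat \<Rightarrow> nat \<Rightarrow> nat set" where
    "K i b = (if b = 2 * i + 1 then {k}
      else if 2 * k - 1 < b \<and> b < 2 * i + 1 then {0}
      else if odd b then {0, 1} else UNIV)" for i b
  let ?R = "\<lambda>i. {p \<in> partitions_of m. \<forall>b\<in>{1..?N}. count p b \<in> K i b}"
  have le: "x \<le> m" if "p \<in> partitions_of m" "x \<in># p" for p x
    using mem_le_sum_mset[OF that(2)] that(1) by (simp add: partitions_of_def)
  \<comment> \<open>Multiplicity conditions on \<open>{1..?N}\<close> suffice for the defining
    condition with \<open>a = 2 * i + 1\<close>, because no part exceeds \<open>m\<close>.\<close>
  have R: "p \<in> ?R i \<longleftrightarrow> p \<in> partitions_of m \<and> count p (2 * i + 1) = k \<and>
      (\<forall>b. b \<in># p \<and> 2 * k - 1 < b \<longrightarrow> 2 * i + 1 \<le> b) \<and>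
      (\<forall>b. odd b \<and> b \<noteq> 2 * i + 1 \<longrightarrow> count p b \<le> 1)" (is "_ \<longleftrightarrow> ?Q p")
    if i: "i \<in> {k..L}" for p i
  proof
    assume "p \<in> ?R i"
    then have p: "p \<in> partitions_of m" and K: "\<And>b. b \<in> {1..?N} \<Longrightarrow> count p b \<in> K i b"
      by auto
    have "2 * i + 1 \<le> b" if "b \<in># p" "2 * k - 1 < b" for b
    proof (rule ccontr)
      assume "\<not> 2 * i + 1 \<le> b"
      then have "K i b = {0}" using that(2) by (simp add: K_def)
      moreover have "count p b \<in> K i b" using le[OF p that(1)] that m by (intro K) auto
      ultimately show False using that(1) by (simp add: count_eq_zero_iff)
    qed
    moreover have "count p b \<le> 1" if "odd b" "b \<noteq> 2 * i + 1" for b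
    proof (cases "b \<in># p")
      case True
      then show ?thesis using K[of b] le[OF p True] that m odd_pos[OF that(1)]
        by (auto simp: K_def split: if_splits)
    qed (simp add: not_in_iff)
    moreover have "count p (2 * i + 1) = k"
      using K[of "2 * i + 1"] i by (auto simp: K_def)
    ultimately show "?Q p" using p by blast
  next
    assume Q: "?Q p"
    have "count p b \<in> K i b" for b
    proof -
      consider "b = 2 * i + 1" | "2 * k - 1 < b" "b < 2 * i + 1"
        | "b \<noteq> 2 * i + 1" "\<not> (2 * k - 1 < b \<and> b < 2 * i + 1)" by blast
      then show ?thesis
      proof cases
        case 2
        then have "b \<notin># p" using Q by force
        then show ?thesis using 2 by (simp add: K_def not_in_iff)
      next
        case 3
        have "odd b \<Longrightarrow> count p b \<le> 1" using Q 3(1) by blast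
        then show ?thesis using 3 by (auto simp: K_def)
      qed (use Q in \<open>simp add: K_def\<close>)
    qed
    then show "p \<in> ?R i" using Q by blast
  qed
  have MP: "MP_set k m = (\<Union>i\<in>{k..L}. ?R i)"
  proof (intro equalityI subsetI)
    fix p assume "p \<in> MP_set k m"
    then obtain a where p: "p \<in> partitions_of m" and a: "a \<in># p" "2 * k - 1 < a" "odd a"
      "\<forall>b. b \<in># p \<and> 2 * k - 1 < b \<longrightarrow> a \<le> b" "count p a = k"
      "\<forall>b. odd b \<and> b \<noteq> a \<longrightarrow> count p b \<le> 1"
      by (auto simp: MP_set_def)
    obtain i where i: "a = 2 * i + 1" using a(3) by (rule oddE)
    have "i \<in> {k..L}" using i a(2) le[OF p a(1)] m k by auto
    moreover have "p \<in> ?R i" using R[OF \<open>i \<in> {k..L}\<close>] p a i by blast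
    ultimately show "p \<in> (\<Union>i\<in>{k..L}. ?R i)" by blast
  next
    fix p assume "p \<in> (\<Union>i\<in>{k..L}. ?R i)"
    then obtain i where i: "i \<in> {k..L}" and p: "p \<in> ?R i" by blast
    have "2 * i + 1 \<in># p" using p R[OF i] k by (intro count_inI) auto
    moreover have "2 * k - 1 < 2 * i + 1" "odd (2 * i + 1)" using i by auto
    ultimately show "p \<in> MP_set k m"
      using p R[OF i, of p] unfolding MP_set_def by blast
  qed
  \<comment> \<open>For \<open>i < j\<close> the part \<open>2*i + 1\<close> must occur
    \<open>k > 0\<close> times in the first set but lies in the empty gap of the second.\<close>
  have disj: "?R i \<inter> ?R j = {}" if "i < j" "i \<in> {k..L}" "j \<in> {k..L}" for i j
  proof -
    have "K i (2 * i + 1) \<inter> K j (2 * i + 1) = {}" "2 * i + 1 \<in> {1..?N}"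
      using that k by (auto simp: K_def)
    then show ?thesis by blast
  qed
  have "card (MP_set k m) = (\<Sum>i=k..L. card (?R i))"
    unfolding MP
  proof (intro card_UN_disjoint ballI impI)
    fix i j assume "i \<in> {k..L}" "j \<in> {k..L}" "i \<noteq> j"
    then show "?R i \<inter> ?R j = {}"
      using disj[of i j] disj[of j i] by (cases "i < j") (auto simp: Int_commute)
  qed (auto simp: finite_partitions_of)
  moreover have "int (card (?R i)) = (head k * (fps_X ^ (k * (2 * i + 1)) * tail L i)) $ m"
    if i: "i \<in> {k..L}" for i
  proof -
    let ?s = "\<lambda>b. multiplicity_series b (K i b)"
    have "int (card (?R i)) = (\<Prod>b=1..?N. ?s b) $ m"
      using card_restricted_multisets[of "{1..?N}" "\<lambda>x. x" "K i" m] restricted_partitions[OF m, of "K i"]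
      by simp
    also have "(\<Prod>b=1..?N. ?s b) = ?s 1 * (\<Prod>j=1..L. ?s (2 * j) * ?s (2 * j + 1))"
      by (rule prod_pairs)
    also have "?s 1 = 1 + fps_X"
      using k i by (auto simp: K_def multiplicity_series_at_most_once[simplified])
    also have "(\<Prod>j=1..L. ?s (2 * j) * ?s (2 * j + 1)) =
        (\<Prod>j=1..L. (if j < k then pair_factor j else 1) *
          ((if j = i then fps_X ^ (k * (2 * i + 1)) else 1) * (if i < j then pair_factor j else 1)))"
    proof (intro prod.cong refl)
      fix j assume j: "j \<in> {1..L}"
      \<comment> \<open>The pair \<open>j = i\<close> keeps only its odd member, since
        \<open>2*i\<close> falls into the gap that must stay empty.\<close>
      consider "j < k" | "k \<le> j" "j < i" | "j = i" | "i < j" using i by force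
      then show "?s (2 * j) * ?s (2 * j + 1) = (if j < k then pair_factor j else 1) *
          ((if j = i then fps_X ^ (k * (2 * i + 1)) else 1) * (if i < j then pair_factor j else 1))"
        by cases (use i j k in \<open>auto simp: K_def pair_factor_def multiplicity_series_singleton
          multiplicity_series_at_most_once[simplified]\<close>)
    qed
    also have "\<dots> = (\<Prod>j=1..L. if j < k then pair_factor j else 1) *
        ((\<Prod>j=1..L. if j = i then fps_X ^ (k * (2 * i + 1)) else 1) *
         (\<Prod>j=1..L. if i < j then pair_factor j else 1))"
      by (simp only: prod.distrib)
    also have "(\<Prod>j=1..L. if j < k then pair_factor j else 1) = (\<Prod>j=1..<k. pair_factor j)"
      using i by (intro prod.mono_neutral_cong_right) auto
    also have "(\<Prod>j=1..L. if j = i then fps_X ^ (k * (2 * i + 1)) else 1) =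
        (fps_X ^ (k * (2 * i + 1)) :: int fps)"
      using i k by (subst prod.delta) auto
    also have "(\<Prod>j=1..L. if i < j then pair_factor j else 1) = tail L i"
      unfolding tail_def by (intro prod.mono_neutral_cong_right) auto
    finally show ?thesis by (simp add: head_def mult_ac)
  qed
  ultimately show ?thesis
    by (simp add: MP_def MP_series_def sum_distrib_left fps_sum_nth)
qed

section \<open>Telescoping of consecutive \<open>MP_series\<close>\<close>

lemma pair_factor_times:
  "0 < i \<Longrightarrow> pair_factor i * (1 - fps_X ^ (2 * i)) = 1 + fps_X ^ (2 * i + 1)"
  using geometric_times[of "2 * i"] by (simp add: pair_factor_def mult_ac mult.left_commute)

lemma head_Suc: "0 < k \<Longrightarrow> head (Suc k) = head k * pair_factor k"
  by (simp add: head_def mult_ac prod.atLeastLessThan_Suc)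

lemma tail_conv_Suc: "m < L \<Longrightarrow> tail L m = pair_factor (Suc m) * tail L (Suc m)"
  by (simp add: tail_def prod.atLeast_Suc_atMost)

text \<open>Shifting one factor at a time from tail to head leaves the full product unchanged
  wherever the cut is made.\<close>

lemma head_times_tail: "k \<le> L \<Longrightarrow> head (Suc k) * tail L k = head (Suc L)"
proof (induction k rule: inc_induct)
  case base
  then show ?case by (simp add: tail_def)
next
  case (step k)
  then show ?case by (simp add: tail_conv_Suc[of k] head_Suc[of "Suc k"] mult_ac)
qed

text \<open>A discrete antiderivative in \<open>m\<close>; for \<open>m < L\<close> the factor
  \<open>1 - q^(2*m+2)\<close> is the denominator of the leading factor of
  \<open>tail L m\<close>.\<close>

definition telescope :: "nat \<Rightarrow> nat \<Rightarrow> nat \<Rightarrow> int fps" where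
  "telescope L k m = fps_X ^ (k * (2 * m + 3)) * (1 - fps_X ^ (2 * m + 2)) * tail L m"

text \<open>Cancelling that denominator makes both terms multiples of
  \<open>q^(k*(2*m+3)) * tail L (Suc m)\<close>; the cofactors are then compared as
  polynomials.\<close>

lemma telescope_diff:
  assumes "m < L"
  shows "telescope L k m - telescope L k (Suc m) =
    fps_X ^ (k * (2 * Suc m + 1)) * tail L (Suc m) *
      (1 - fps_X ^ (2 * k) + fps_X ^ (2 * Suc m + 1) * (1 + fps_X ^ (2 * k + 1)))"
proof -
  let ?X = "fps_X :: int fps"
  have "telescope L k m =
      ?X ^ (k * (2 * Suc m + 1)) * (pair_factor (Suc m) * (1 - ?X ^ (2 * Suc m))) * tail L (Suc m)"
  proof -
    have "2 * m + 3 = 2 * Suc m + 1" "2 * m + 2 = 2 * Suc m" by simp_all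
    then show ?thesis by (simp only: telescope_def tail_conv_Suc[OF assms] mult_ac)
  qed
  also have "\<dots> = ?X ^ (k * (2 * Suc m + 1)) * (1 + ?X ^ (2 * Suc m + 1)) * tail L (Suc m)"
    by (subst pair_factor_times) simp_all
  finally have 1: "telescope L k m = \<dots>" .
  have "k * (2 * Suc m + 3) = k * (2 * Suc m + 1) + 2 * k" by (simp add: algebra_simps)
  then have "telescope L k (Suc m) =
      ?X ^ (k * (2 * Suc m + 1)) * ?X ^ (2 * k) * (1 - ?X ^ (2 * Suc m + 2)) * tail L (Suc m)"
    by (simp only: telescope_def power_add)
  also have "?X ^ (2 * Suc m + 2) = ?X ^ (2 * Suc m + 1) * ?X" by simp
  finally have 2: "telescope L k (Suc m) =
      ?X ^ (k * (2 * Suc m + 1)) * ?X ^ (2 * k) * (1 - ?X ^ (2 * Suc m + 1) * ?X) * tail L (Suc m)" .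
  have 3: "?X ^ (2 * k + 1) = ?X ^ (2 * k) * ?X" by simp
  \<comment> \<open>Here \<open>x\<close> stands for \<open>q^(2 * Suc m + 1)\<close>,
    \<open>a\<close> for \<open>q^(2*k)\<close>, \<open>u\<close> for the common power and
    \<open>t\<close> for the tail.\<close>
  have "u * (1 + x) * t - u * a * (1 - x * ?X) * t = u * t * (1 - a + x * (1 + a * ?X))"
    for u x t a by (simp add: algebra_simps)
  then show ?thesis unfolding 1 2 3 .
qed

lemma sum_telescope:
  assumes "k \<le> L"
  shows "(\<Sum>m=Suc k..L. fps_X ^ (i * (2 * m + 1)) * tail L m *
      (1 - fps_X ^ (2 * i) + fps_X ^ (2 * m + 1) * (1 + fps_X ^ (2 * i + 1)))) =
    telescope L i k - telescope L i L"
proof -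
  \<comment> \<open>The upper limit varies separately from \<open>L\<close>, which also occurs
    inside \<open>tail L\<close> and must stay fixed.\<close>
  have "(\<Sum>m=Suc k..M. fps_X ^ (i * (2 * m + 1)) * tail L m *
      (1 - fps_X ^ (2 * i) + fps_X ^ (2 * m + 1) * (1 + fps_X ^ (2 * i + 1)))) =
    telescope L i k - telescope L i M" if "k \<le> M" "M \<le> L" for M
    using that
  proof (induction M rule: dec_induct)
    case (step M)
    then show ?case
      using telescope_diff[of M L i, symmetric] by (simp del: power_Suc mult_Suc_right)
  qed simp
  then show ?thesis using assms by simp
qed

text \<open>The case \<open>i = 0\<close> of the telescoping sum is the base case of the induction.\<close>

lemma MP_series_1:
  "MP_series L 1 = head (Suc L) * (1 - fps_X) - 1 + fps_X ^ (2 * L + 2)"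
proof -
  \<comment> \<open>At exponent 0 the term \<open>1 - q^0\<close> vanishes, and the remaining
    \<open>1 + q\<close> is \<open>head 1\<close>.\<close>
  have "MP_series L 1 = (\<Sum>m=Suc 0..L. fps_X ^ (0 * (2 * m + 1)) * tail L m *
      (1 - fps_X ^ (2 * 0) + fps_X ^ (2 * m + 1) * (1 + fps_X ^ (2 * 0 + 1))))"
    by (simp add: MP_series_def head_def sum_distrib_left mult_ac)
  also have "\<dots> = telescope L 0 0 - telescope L 0 L"
    by (rule sum_telescope) simp
  also have "telescope L 0 0 = (head 1 * tail L 0) * (1 - fps_X)"
    by (simp add: telescope_def head_def algebra_simps power2_eq_square)
  also have "head 1 * tail L 0 = head (Suc L)"
    using head_times_tail[of 0 L] by simp
  also have "telescope L 0 L = 1 - fps_X ^ (2 * L + 2)"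
    by (simp add: telescope_def tail_def)
  finally show ?thesis by simp
qed

text \<open>Over the common denominator \<open>1 - q^(2*k)\<close> the terms with
  \<open>m > k\<close> add up to a telescoping sum. Its lower end combines with the term
  \<open>m = k\<close> of the first series to the main term; its upper end is the truncation
  error.\<close>

lemma MP_series_add_Suc:
  assumes k: "0 < k" "k \<le> L"
  shows "MP_series L k + MP_series L (Suc k) =
    head (Suc L) * (fps_X ^ (k * (2 * k + 1)) * (1 - fps_X ^ (2 * k + 1)))
      - geometric (2 * k) * head k * telescope L k L"
proof -
  let ?X = "fps_X :: int fps"
  let ?a = "1 - ?X ^ (2 * k)" and ?b = "1 + ?X ^ (2 * k + 1)" and ?g = "geometric (2 * k)"
  let ?s = "\<lambda>m. ?X ^ (k * (2 * m + 1)) * tail L m"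
  have g: "?g * ?a = 1" using k by (intro geometric_times) simp
  have head: "head (Suc k) = head k * ?g * ?b"
    using k by (simp add: head_Suc pair_factor_def mult_ac)
  have "?X ^ (Suc k * (2 * m + 1)) * tail L m = ?s m * ?X ^ (2 * m + 1)" for m
    by (simp only: mult_Suc power_add mult_ac)
  then have M: "MP_series L (Suc k) =
      head k * ?g * (\<Sum>m=Suc k..L. ?s m * (?X ^ (2 * m + 1) * ?b))"
    by (simp only: MP_series_def head sum_distrib_left mult_ac)
  \<comment> \<open>Inserting \<open>?g * ?a = 1\<close> creates the common denominator; the term
    \<open>m = k\<close> is split off because the other sum starts at \<open>Suc k\<close>.\<close>
  have "MP_series L k = head k * (?g * ?a) * (?s k + (\<Sum>m=Suc k..L. ?s m))"
    using k by (simp add: g MP_series_def sum.atLeast_Suc_atMost)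
  then have "MP_series L k + MP_series L (Suc k) = head k * ?g *
      (?s k * ?a + (\<Sum>m=Suc k..L. ?s m * (?a + ?X ^ (2 * m + 1) * ?b)))"
    unfolding M by (simp only: distrib_left sum.distrib sum_distrib_left mult_ac add.assoc)
  also have "(\<Sum>m=Suc k..L. ?s m * (?a + ?X ^ (2 * m + 1) * ?b)) =
      telescope L k k - telescope L k L"
    using k by (intro sum_telescope) simp
  also have "telescope L k k = ?s k * (?X ^ (2 * k) * (1 - ?X ^ (2 * k + 2)))"
  proof -
    have "k * (2 * k + 3) = k * (2 * k + 1) + 2 * k" by (simp add: algebra_simps)
    then show ?thesis by (simp only: telescope_def power_add mult_ac)
  qed
  also have "head k * ?g * (?s k * ?a + (?s k * (?X ^ (2 * k) * (1 - ?X ^ (2 * k + 2)))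
        - telescope L k L)) =
      (head k * ?g * tail L k) * ?X ^ (k * (2 * k + 1)) *
        (?a + ?X ^ (2 * k) * (1 - ?X ^ (2 * k + 2))) - ?g * head k * telescope L k L"
    by (simp only: algebra_simps)
  \<comment> \<open>Both sides equal \<open>1 - q^(4*k+2)\<close>; the factor \<open>?b\<close> then
    completes \<open>head k * ?g\<close> to \<open>head (Suc k)\<close>.\<close>
  also have "?a + ?X ^ (2 * k) * (1 - ?X ^ (2 * k + 2)) = ?b * (1 - ?X ^ (2 * k + 1))"
  proof -
    have "1 - a + a * (1 - a * ?X * ?X) = (1 + a * ?X) * (1 - a * ?X)" for a
      by (simp add: algebra_simps)
    moreover have e: "?X ^ (2 * k + 2) = ?X ^ (2 * k) * ?X * ?X" "?X ^ (2 * k + 1) = ?X ^ (2 * k) * ?X"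
      by simp_all
    ultimately show ?thesis unfolding e by blast
  qed
  also have "(head k * ?g * tail L k) * ?X ^ (k * (2 * k + 1)) * (?b * (1 - ?X ^ (2 * k + 1))) =
      (head (Suc k) * tail L k) * (?X ^ (k * (2 * k + 1)) * (1 - ?X ^ (2 * k + 1)))"
    by (simp only: head mult_ac)
  also have "head (Suc k) * tail L k = head (Suc L)"
    using k by (intro head_times_tail) simp
  finally show ?thesis .
qed

section \<open>The truncated theta identity\<close>

definition partial_theta :: "nat \<Rightarrow> int fps" where
  "partial_theta k = (\<Sum>j<2 * k. (-1) ^ (j * (j + 1) div 2) * fps_X ^ (j * (j + 1) div 2))"

text \<open>The new exponents are \<open>k*(2*k+1)\<close> and \<open>(k+1)*(2*k+1)\<close>; they
  differ by an odd number, so the signs are opposite. The increment matches the main term of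
  \<open>MP_series_add_Suc\<close>.\<close>

lemma partial_theta_Suc:
  "partial_theta (Suc k) = partial_theta k +
    (-1) ^ k * (fps_X ^ (k * (2 * k + 1)) * (1 - fps_X ^ (2 * k + 1)))"
proof -
  have T: "2 * k * (2 * k + 1) div 2 = k * (2 * k + 1)"
    "(2 * k + 1) * (2 * k + 1 + 1) div 2 = k * (2 * k + 1) + (2 * k + 1)"
    by (simp_all add: algebra_simps)
  have sgn: "(-1) ^ (k * (2 * k + 1)) = ((-1) ^ k :: int fps)"
    by (subst mult.commute, subst power_mult) simp
  have "partial_theta (Suc k) = partial_theta k +
     ((-1) ^ (2 * k * (2 * k + 1) div 2) * fps_X ^ (2 * k * (2 * k + 1) div 2) +
      (-1) ^ ((2 * k + 1) * (2 * k + 1 + 1) div 2) *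
        fps_X ^ ((2 * k + 1) * (2 * k + 1 + 1) div 2))"
    unfolding partial_theta_def mult_Suc_right[of 2 k] add_2_eq_Suc sum.lessThan_Suc
    by (simp only: Suc_eq_plus1 add.assoc)
  also have "\<dots> = partial_theta k +
    (-1) ^ k * (fps_X ^ (k * (2 * k + 1)) * (1 - fps_X ^ (2 * k + 1)))"
    unfolding T power_add sgn by (simp add: algebra_simps)
  finally show ?thesis .
qed

text \<open>Bounding the parts turns the identity into a congruence. In the induction step
  \<open>MP_series_add_Suc\<close> replaces the theta increment, the old series cancels, and only
  the boundary term is left. The index is one less than in the final theorem.\<close>

lemma truncated_theta:
  assumes "k < L"
  shows "fps_X ^ (2 * L + 2) dvd
    head (Suc L) * partial_theta (Suc k) - (1 + (-1) ^ k * MP_series L (Suc k))"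
  using assms
proof (induction k)
  case 0
  have "partial_theta (Suc 0) = 1 - fps_X"
    by (subst partial_theta_Suc) (simp add: partial_theta_def)
  then show ?case using MP_series_1[of L] by simp
next
  case (Suc k)
  let ?D = "\<lambda>k. head (Suc L) * partial_theta (Suc k) - (1 + (-1) ^ k * MP_series L (Suc k))"
  let ?e = "geometric (2 * Suc k) * head (Suc k) * telescope L (Suc k) L"
  let ?t = "head (Suc L) * (fps_X ^ (Suc k * (2 * Suc k + 1)) * (1 - fps_X ^ (2 * Suc k + 1)))"
  have t: "?t = MP_series L (Suc k) + MP_series L (Suc (Suc k)) + ?e"
    using MP_series_add_Suc[of "Suc k" L] Suc.prems by simp
  have "?D (Suc k) = head (Suc L) * partial_theta (Suc k) + (-1) ^ Suc k * ?t
      - (1 + (-1) ^ Suc k * MP_series L (Suc (Suc k)))"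
    unfolding partial_theta_Suc[of "Suc k"] by (simp only: algebra_simps)
  also have "\<dots> = ?D k + (-1) ^ Suc k * ?e"
    unfolding t by (simp add: algebra_simps)
  finally have step: "?D (Suc k) = ?D k + (-1) ^ Suc k * ?e" .
  \<comment> \<open>The boundary term \<open>telescope L (Suc k) L\<close> contains this power,
    whose exponent is at least \<open>2*L + 3\<close>.\<close>
  have "fps_X ^ (2 * L + 2) dvd (fps_X ^ (Suc k * (2 * L + 3)) :: int fps)"
    by (rule le_imp_power_dvd) simp
  then have "fps_X ^ (2 * L + 2) dvd ?e"
    by (simp only: telescope_def dvd_mult dvd_mult2)
  moreover have "fps_X ^ (2 * L + 2) dvd ?D k"
    using Suc by simp
  ultimately show ?case
    unfolding step by (rule dvd_add[OF _ dvd_mult, rotated])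
qed

section \<open>Comparison of the products and extraction of coefficients\<close>

text \<open>Serves to discard truncation errors: the elements congruent to 1 modulo \<open>d\<close>
  are closed under multiplication.\<close>

lemma dvd_prod_minus_1:
  fixes d :: "'a :: comm_ring_1"
  assumes "\<And>x. x \<in> A \<Longrightarrow> d dvd f x - 1"
  shows "d dvd prod f A - 1"
  using assms
proof (induction A rule: infinite_finite_induct)
  case (insert x A)
  have "prod f (insert x A) - 1 = f x * (prod f A - 1) + (f x - 1)"
    using insert by (simp add: algebra_simps)
  moreover have "d dvd f x * (prod f A - 1)" "d dvd f x - 1"
    using insert by simp_all
  ultimately show ?case by (simp only: dvd_add)
qed simp_all

text \<open>Factorwise this is \<open>1 + q ^ b = (1 - q ^ (2 * b)) / (1 - q ^ b)\<close>; the last product on the right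
  is the truncation error.\<close>

lemma euler_factors:
  "(\<Prod>i=1..L. 1 + fps_X ^ (2 * i)) * head (Suc L) =
    (\<Prod>b=1..2 * L + 1. geometric b) * (\<Prod>b=L + 1..2 * L + 1. 1 - fps_X ^ (2 * b))"
proof -
  let ?X = "fps_X :: int fps"
  have "(\<Prod>i=1..L. 1 + ?X ^ (2 * i)) * head (Suc L) =
      (\<Prod>b=1..2 * L + 1. 1 + ?X ^ b) * (\<Prod>i=1..L. geometric (2 * i))"
    unfolding prod_pairs
    by (simp add: head_def pair_factor_def prod.distrib mult_ac atLeastLessThanSuc_atLeastAtMost)
  also have "(\<Prod>b=1..2 * L + 1. 1 + ?X ^ b) =
      (\<Prod>b=1..2 * L + 1. geometric b * (1 - ?X ^ (2 * b)))"
  proof (intro prod.cong refl)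
    fix b assume "b \<in> {1..2 * L + 1}"
    then have "geometric b * (1 - ?X ^ b) = 1" by (intro geometric_times) simp
    then have "1 + ?X ^ b = (geometric b * (1 - ?X ^ b)) * (1 + ?X ^ b)" by simp
    also have "\<dots> = geometric b * (1 - ?X ^ (2 * b))"
      unfolding mult_2 power_add by (simp add: algebra_simps)
    finally show "1 + ?X ^ b = geometric b * (1 - ?X ^ (2 * b))" .
  qed
  also have "\<dots> = (\<Prod>b=1..2 * L + 1. geometric b) *
      ((\<Prod>b=1..L. 1 - ?X ^ (2 * b)) * (\<Prod>b=L + 1..2 * L + 1. 1 - ?X ^ (2 * b)))"
    using prod.ub_add_nat[of 1 L "\<lambda>b. 1 - ?X ^ (2 * b)" "L + 1"]
    by (simp add: prod.distrib mult_2)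
  \<comment> \<open>The factors with \<open>b \<le> L\<close> cancel against the geometric series of
    even weights; those with \<open>b > L\<close> remain.\<close>
  also have "\<dots> * (\<Prod>i=1..L. geometric (2 * i)) =
      (\<Prod>b=1..2 * L + 1. geometric b) * (\<Prod>b=L + 1..2 * L + 1. 1 - ?X ^ (2 * b)) *
      (\<Prod>i=1..L. geometric (2 * i) * (1 - ?X ^ (2 * i)))"
    by (simp only: prod.distrib mult_ac)
  also have "(\<Prod>i=1..L. geometric (2 * i) * (1 - ?X ^ (2 * i))) = 1"
    by (intro prod.neutral ballI geometric_times) simp
  finally show ?thesis by simp
qed

lemma fps_nth_eq_if_X_power_dvd:
  fixes f g :: "'a :: comm_ring_1 fps"
  assumes "fps_X ^ m dvd f - g" "n < m"
  shows "f $ n = g $ n"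
proof -
  obtain h where "f - g = fps_X ^ m * h" using assms(1) by (rule dvdE)
  then have "(f - g) $ n = 0" using assms(2) by (simp add: fps_X_power_mult_nth)
  then show ?thesis by simp
qed

theorem theorem6:
  fixes n k :: nat
  assumes "n > 0" and "k > 0"
  shows "(- 1 :: int) ^ (k - 1) *
      ((\<Sum>j = 0..2 * k - 1.
          (- 1) ^ (j * (j + 1) div 2) * int (sigma_mex (int n - int (j * (j + 1) div 2))))
        - int (D2_star n))
    = int (\<Sum>j = 0..n. MP k j * D2_star (n - j))"
proof -
  \<comment> \<open>Large enough for \<open>k - 1 < L\<close> in the theta identity and for
    \<open>n < 2*L + 2\<close>, so that the congruences determine the coefficient at
    \<open>n\<close>.\<close>
  define L where "L = n + k"
  let ?N = "2 * L + 1"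
  let ?\<psi> = "triangular_series ?N"
  let ?A = "?\<psi> * (\<Prod>b=1..?N. geometric b)"
  let ?D = "?\<psi> * (\<Prod>i=1..L. 1 + fps_X ^ (2 * i))"
  let ?P = "head (Suc L)" and ?S = "partial_theta k" and ?M = "MP_series L k"
  let ?s = "(-1) ^ (k - 1) :: int fps"
  have s: "?s * ?s = 1" by (simp flip: power_mult_distrib)
  have "fps_X ^ (2 * L + 2) dvd (\<Prod>b=L + 1..?N. 1 - fps_X ^ (2 * b)) - (1 :: int fps)"
  proof (intro dvd_prod_minus_1)
    fix b assume "b \<in> {L + 1..?N}"
    then have "fps_X ^ (2 * L + 2) dvd (fps_X ^ (2 * b) :: int fps)"
      by (intro le_imp_power_dvd) simp
    then show "fps_X ^ (2 * L + 2) dvd 1 - fps_X ^ (2 * b) - (1 :: int fps)"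
      using dvd_minus_iff[of _ "fps_X ^ (2 * b)"] by (simp del: power_Suc add_2_eq_Suc')
  qed
  then have "fps_X ^ (2 * L + 2) dvd ?A * ((\<Prod>b=L + 1..?N. 1 - fps_X ^ (2 * b)) - 1)"
    by (rule dvd_mult)
  moreover have "?D * ?P = ?A * (\<Prod>b=L + 1..?N. 1 - fps_X ^ (2 * b))"
    using euler_factors[of L] by (simp only: mult.assoc)
  ultimately have DP: "fps_X ^ (2 * L + 2) dvd ?D * ?P - ?A"
    by (simp add: right_diff_distrib)
  have PS: "fps_X ^ (2 * L + 2) dvd ?P * ?S - (1 + ?s * ?M)"
    using truncated_theta[of "k - 1" L] assms by (simp add: L_def)
  \<comment> \<open>An exact ring identity expressing the target difference through the two
    congruences; the last summand vanishes because the sign squares to 1.\<close>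
  have "?s * (?A * ?S - ?D) - ?M * ?D =
      ?s * (?D * (?P * ?S - (1 + ?s * ?M)) - (?D * ?P - ?A) * ?S) + (?s * ?s - 1) * (?M * ?D)"
    by (simp only: algebra_simps mult_1_left)
  also have "\<dots> = ?s * (?D * (?P * ?S - (1 + ?s * ?M)) - (?D * ?P - ?A) * ?S)"
    by (simp add: s)
  finally have "fps_X ^ (2 * L + 2) dvd ?s * (?A * ?S - ?D) - ?M * ?D"
    using DP PS by (simp only: dvd_mult dvd_mult2 dvd_diff)
  then have "(?s * (?A * ?S - ?D)) $ n = (?M * ?D) $ n"
    by (rule fps_nth_eq_if_X_power_dvd) (simp add: L_def)
  moreover have "(?s * (?A * ?S - ?D)) $ n = (-1) ^ (k - 1) * ((?A * ?S) $ n - ?D $ n)"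
    by (cases "even (k - 1)") simp_all
  moreover have "(?A * ?S) $ n = (\<Sum>j = 0..2 * k - 1.
      (- 1) ^ (j * (j + 1) div 2) * int (sigma_mex (int n - int (j * (j + 1) div 2))))"
  proof -
    have "(?A * ((-1) ^ t * fps_X ^ t)) $ n = (-1) ^ t * int (sigma_mex (int n - int t))" for t
    proof (cases "n < t")
      \<comment> \<open>The shift by \<open>q^t\<close> makes the coefficient 0, in agreement with
        the value of \<open>sigma_mex\<close> at negative arguments.\<close>
      case True
      then show ?thesis
        by (cases "even t") (simp_all add: fps_X_power_mult_right_nth sigma_mex_def)
    next
      case False
      then have "int (sigma_mex (int n - int t)) = ?A $ (n - t)"
        using sigma_mex_nth[of "n - t" ?N] by (simp add: L_def of_nat_diff)
      with False show ?thesis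
        by (cases "even t") (simp_all add: fps_X_power_mult_right_nth)
    qed
    moreover have "{..<2 * k} = {0..2 * k - 1}" using assms by auto
    ultimately show ?thesis
      by (simp add: partial_theta_def sum_distrib_left fps_sum_nth)
  qed
  moreover have "?D $ n = int (D2_star n)"
    by (rule D2_star_nth[symmetric]) (simp add: L_def)
  moreover have "(?M * ?D) $ n = int (\<Sum>j = 0..n. MP k j * D2_star (n - j))"
    unfolding fps_mult_nth[of ?M ?D] of_nat_sum of_nat_mult
    by (intro sum.cong refl arg_cong2[where f = "(*)"] MP_nth[symmetric] D2_star_nth[symmetric])
       (use assms in \<open>simp_all add: L_def\<close>)
  ultimately show ?thesis by simp
qed

end
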